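(* Let $I$ be $[0,a)$ (with $a>0$) or $[0,\infty)$, and let $f:I\to\mathbb{R}$ be a superquadratic function on $I$ that is differentiable with $f'$ superadditive. Let $x_1\le x_2\le\dots\le x_n$ be points of $I$. Let $\mathbf{p}=(p_1,\dots,p_n)$ and $\mathbf{q}=(q_1,\dots,q_n)$ be real $n$-tuples with $\mathbf{p}\ne\mathbf{q}$, $\sum_{i=1}^n p_i=\sum_{i=1}^n q_i=1$, $0\le\sum_{j=1}^i p_j\le1$ for $i=1,\dots,n$, and $0<\sum_{j=1}^i q_j<1$ for $i=1,\dots,n-1$. Put $$m_i=\frac{\sum_{j=1}^i p_j}{\sum_{j=1}^i q_j},\qquad \overline{m}_i=\frac{\sum_{j=i}^n p_j}{\sum_{j=i}^n q_j},\qquad i=1,\dots,n,$$ $$m^*=\min_{1\le i\le n}\{m_i,\overline{m}_i\},\qquad M^*=\max_{1\le i\le n}\{m_i,\overline{m}_i\}.$$ Then $$J_n(f,\mathbf{x},\mathbf{p})-m^*J_n(f,\mathbf{x},\mathbf{q})\ge m^*f\left(\left|\sum_{i=1}^n(q_i-p_i)x_i\right|\right)+\sum_{i=1}^n(p_i-m^*q_i)f\left(\left|x_i-\sum_{j=1}^n p_jx_j\right|\right)$$ and $$J_n(f,\mathbf{x},\mathbf{p})-M^*J_n(f,\mathbf{x},\mathbf{q})\le-\sum_{i=1}^n(M^*q_i-p_i)f\left(\left|x_i-\sum_{j=1}^n q_jx_j\right|\right)-f\left(\left|\sum_{i=1}^n(p_i-q_i)x_i\right|\right).$$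
   Context: For $\mathbf{x}=(x_1,\dots,x_n)$ and $\mathbf{p}=(p_1,\dots,p_n)$, the Jensen functional is $J_n(f,\mathbf{x},\mathbf{p})=\sum_{i=1}^n p_if(x_i)-f\left(\sum_{i=1}^n p_ix_i\right)$. A function $f:I\to\mathbb{R}$ is superquadratic on $I$ if for every $x\in I$ there is $C_x\in\mathbb{R}$ with $f(y)\ge f(x)+C_x(y-x)+f(|y-x|)$ for all $y\in I$. The function $f'$ is superadditive on $I$ if $f'(x+y)\ge f'(x)+f'(y)$ whenever $x,y,x+y\in I$ (with $f'(0)$ the one-sided derivative). The entries of $\mathbf{p},\mathbf{q}$ may be negative. *)

theory Defs
  imports Complex_Main
begin

text \<open>An \<open>n\<close>-tuple is a function on \<open>nat\<close> of which only the values at \<open>1, \<dots>, n\<close> matter.\<close>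

definition jensen_functional ::
    "nat \<Rightarrow> (real \<Rightarrow> real) \<Rightarrow> (nat \<Rightarrow> real) \<Rightarrow> (nat \<Rightarrow> real) \<Rightarrow> real" where
  "jensen_functional n f x p = (\<Sum>i=1..n. p i * f (x i)) - f (\<Sum>i=1..n. p i * x i)"

definition superquadratic_on :: "real set \<Rightarrow> (real \<Rightarrow> real) \<Rightarrow> bool" where
  "superquadratic_on I f \<longleftrightarrow>
     (\<forall>x\<in>I. \<exists>C. \<forall>y\<in>I. f y \<ge> f x + C * (y - x) + f \<bar>y - x\<bar>)"

definition superadditive_on :: "real set \<Rightarrow> (real \<Rightarrow> real) \<Rightarrow> bool" where
  "superadditive_on I g \<longleftrightarrow>
     (\<forall>x\<in>I. \<forall>y\<in>I. x + y \<in> I \<longrightarrow> g (x + y) \<ge> g x + g y)"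

definition head_ratio :: "(nat \<Rightarrow> real) \<Rightarrow> (nat \<Rightarrow> real) \<Rightarrow> nat \<Rightarrow> real" where
  "head_ratio p q i = (\<Sum>j=1..i. p j) / (\<Sum>j=1..i. q j)"

definition tail_ratio :: "nat \<Rightarrow> (nat \<Rightarrow> real) \<Rightarrow> (nat \<Rightarrow> real) \<Rightarrow> nat \<Rightarrow> real" where
  "tail_ratio n p q i = (\<Sum>j=i..n. p j) / (\<Sum>j=i..n. q j)"

definition min_ratio :: "nat \<Rightarrow> (nat \<Rightarrow> real) \<Rightarrow> (nat \<Rightarrow> real) \<Rightarrow> real" where
  "min_ratio n p q = Min (head_ratio p q ` {1..n} \<union> tail_ratio n p q ` {1..n})"

definition max_ratio :: "nat \<Rightarrow> (nat \<Rightarrow> real) \<Rightarrow> (nat \<Rightarrow> real) \<Rightarrow> real" where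
  "max_ratio n p q = Max (head_ratio p q ` {1..n} \<union> tail_ratio n p q ` {1..n})"

end

theory Submission
  imports Defs
begin

text \<open>
  With \<open>P = \<Sum> p\<^sub>i x\<^sub>i\<close> and \<open>Q = \<Sum> q\<^sub>i x\<^sub>i\<close>, both inequalities have the form
  \<open>\<Sum> r\<^sub>i g(x\<^sub>i) + s g(y) \<ge> 0\<close>, where
  \<open>g(y) = f(y) - f(c) - f(\<bar>y - c\<bar>) - f'(c) (y - c)\<close>: the first one for \<open>c = P\<close>, \<open>r = p - m\<^sup>* q\<close>,
  \<open>s = m\<^sup>*\<close>, \<open>y = Q\<close>, the second one for \<open>c = Q\<close>, \<open>r = M\<^sup>* q - p\<close>, \<open>s = 1\<close>, \<open>y = P\<close>; the linear
  terms cancel. Superadditivity of \<open>f'\<close> makes \<open>g\<close> decreasing to the left of \<open>c\<close> and increasing to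
  its right, and \<open>g(c) = -f(0) \<ge> 0\<close>. By the choice of \<open>m\<^sup>*\<close> and \<open>M\<^sup>*\<close> all sums of an initial or a
  final segment of \<open>r\<close> are nonnegative, so Abel summation on either side of \<open>c\<close> gives the claim.
\<close>

section \<open>Abel summation with signed weights\<close>

text \<open>Summation by parts: with head sums \<open>R i\<close>, the sum equals
  \<open>R n * h n\<close> plus the terms \<open>R i * (h i - h (i + 1))\<close> for
  \<open>i < n\<close>, all of them nonnegative.\<close>

lemma sum_mult_antimono_nonneg:
  fixes r h :: "nat \<Rightarrow> real"
  assumes heads: "\<And>i. i \<in> {1..n} \<Longrightarrow> 0 \<le> (\<Sum>j=1..i. r j)"
    and anti: "antimono_on {1..n} h"
    and nonneg: "\<And>i. i \<in> {1..n} \<Longrightarrow> 0 \<le> h i"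
  shows "0 \<le> (\<Sum>i=1..n. r i * h i)"
proof (cases "n = 0")
  case False
  \<comment> \<open>Summation by parts as an induction: passing from \<open>h k\<close> to the
    smaller \<open>h (Suc k)\<close> can only lower the left side, since its head sum is
    nonnegative.\<close>
  have "(\<Sum>i=1..k. r i) * h k \<le> (\<Sum>i=1..k. r i * h i)" if "1 \<le> k" "k \<le> n" for k
    using that
  proof (induction k rule: dec_induct)
    case (step k)
    have "h (Suc k) \<le> h k"
      using anti step by (auto simp: monotone_on_def)
    with heads[of k] step have "(\<Sum>i=1..k. r i) * h (Suc k) \<le> (\<Sum>i=1..k. r i) * h k"
      by (intro mult_left_mono) auto
    with step show ?case
      by (simp add: algebra_simps)
  qed simp
  from this[of n] False have "(\<Sum>i=1..n. r i) * h n \<le> (\<Sum>i=1..n. r i * h i)"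
    by simp
  moreover have "0 \<le> (\<Sum>i=1..n. r i) * h n"
    using False by (intro mult_nonneg_nonneg heads nonneg) auto
  ultimately show ?thesis
    by linarith
qed simp

text \<open>Mirror image of the previous lemma: the reflection \<open>j \<mapsto> n + 1 - j\<close>
  turns tail sums into head sums and increasing into decreasing.\<close>

lemma sum_mult_mono_nonneg:
  fixes r h :: "nat \<Rightarrow> real"
  assumes tails: "\<And>i. i \<in> {1..n} \<Longrightarrow> 0 \<le> (\<Sum>j=i..n. r j)"
    and mono: "mono_on {1..n} h"
    and nonneg: "\<And>i. i \<in> {1..n} \<Longrightarrow> 0 \<le> h i"
  shows "0 \<le> (\<Sum>i=1..n. r i * h i)"
proof -
  have rev: "(\<Sum>j=1..i. r (n + 1 - j)) = (\<Sum>j=n + 1 - i..n. r j)" if "i \<le> n" for i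
    using that
    by (intro sum.reindex_bij_witness[where i = "\<lambda>j. n + 1 - j" and j = "\<lambda>j. n + 1 - j"]) auto
  have "0 \<le> (\<Sum>i=1..n. r (n + 1 - i) * h (n + 1 - i))"
  proof (rule sum_mult_antimono_nonneg)
    show "0 \<le> (\<Sum>j=1..i. r (n + 1 - j))" if "i \<in> {1..n}" for i
    proof -
      have "n + 1 - i \<in> {1..n}"
        using that by auto
      with that show ?thesis
        using tails rev by (metis atLeastAtMost_iff)
    qed
    show "antimono_on {1..n} (\<lambda>i. h (n + 1 - i))"
    proof (rule monotone_onI)
      fix i j assume "i \<in> {1..n}" "j \<in> {1..n}" "i \<le> j"
      then show "h (n + 1 - j) \<le> h (n + 1 - i)"
        by (intro mono_onD[OF mono]) auto
    qed
    show "0 \<le> h (n + 1 - i)" if "i \<in> {1..n}" for i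
      using that by (intro nonneg) auto
  qed
  also have "\<dots> = (\<Sum>i=1..n. r i * h i)"
    by (rule sum.reindex_bij_witness[where i = "\<lambda>j. n + 1 - j" and j = "\<lambda>j. n + 1 - j"]) auto
  finally show ?thesis .
qed

text \<open>Cut \<open>g\<close> at \<open>c\<close> into two pieces, each extended by 0. As
  \<open>g\<close> is nonnegative, the extensions stay monotone along the ordered points: the left
  piece decreases and is handled by head sums, the right piece increases and is handled by tail
  sums.\<close>

lemma sum_mult_unimodal_nonneg:
  fixes r x :: "nat \<Rightarrow> real" and g :: "real \<Rightarrow> real"
  assumes heads: "\<And>i. i \<in> {1..n} \<Longrightarrow> 0 \<le> (\<Sum>j=1..i. r j)"
    and tails: "\<And>i. i \<in> {1..n} \<Longrightarrow> 0 \<le> (\<Sum>j=i..n. r j)"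
    and x: "mono_on {1..n} x" "\<And>i. i \<in> {1..n} \<Longrightarrow> x i \<in> I"
    and left: "antimono_on (I \<inter> {..c}) g"
    and right: "mono_on (I \<inter> {c..}) g"
    and nonneg: "\<And>y. y \<in> I \<Longrightarrow> 0 \<le> g y"
  shows "0 \<le> (\<Sum>i=1..n. r i * g (x i))"
proof -
  have le: "x i \<le> x j" if "i \<in> {1..n}" "j \<in> {1..n}" "i \<le> j" for i j
    using x(1) that by (auto simp: monotone_on_def)
  have "0 \<le> (\<Sum>i=1..n. r i * (if x i \<le> c then g (x i) else 0))"
  proof (rule sum_mult_antimono_nonneg[OF heads])
    show "antimono_on {1..n} (\<lambda>i. if x i \<le> c then g (x i) else 0)"
    proof (rule monotone_onI)
      fix i j assume ij: "i \<in> {1..n}" "j \<in> {1..n}" "i \<le> j"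
      show "(if x j \<le> c then g (x j) else 0) \<le> (if x i \<le> c then g (x i) else 0)"
        using le[OF ij] x(2)[OF ij(1)] x(2)[OF ij(2)] nonneg left
        by (auto simp: monotone_on_def)
    qed
  qed (use x(2) nonneg in auto)
  moreover have "0 \<le> (\<Sum>i=1..n. r i * (if x i \<le> c then 0 else g (x i)))"
  proof (rule sum_mult_mono_nonneg[OF tails])
    show "mono_on {1..n} (\<lambda>i. if x i \<le> c then 0 else g (x i))"
    proof (rule monotone_onI)
      fix i j assume ij: "i \<in> {1..n}" "j \<in> {1..n}" "i \<le> j"
      show "(if x i \<le> c then 0 else g (x i)) \<le> (if x j \<le> c then 0 else g (x j))"
        using le[OF ij] x(2)[OF ij(1)] x(2)[OF ij(2)] nonneg right
        by (auto simp: monotone_on_def)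
    qed
  qed (use x(2) nonneg in auto)
  moreover have "(\<Sum>i=1..n. r i * g (x i)) =
      (\<Sum>i=1..n. r i * (if x i \<le> c then g (x i) else 0))
      + (\<Sum>i=1..n. r i * (if x i \<le> c then 0 else g (x i)))"
    by (subst sum.distrib[symmetric], intro sum.cong) auto
  ultimately show ?thesis
    by linarith
qed

section \<open>Functions with superadditive derivative\<close>

text \<open>At \<open>x = y = 0\<close> the defining inequality reads
  \<open>f 0 \<ge> f 0 + f 0\<close>. This sign makes \<open>excess\<close> nonnegative at its
  minimum.\<close>

lemma superquadratic_on_zero:
  assumes "superquadratic_on I f" "0 \<in> I"
  shows "f 0 \<le> 0"
proof -
  obtain C where "\<forall>y\<in>I. f 0 + C * (y - 0) + f \<bar>y - 0\<bar> \<le> f y"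
    using assms unfolding superquadratic_on_def by blast
  then have "f 0 + C * (0 - 0) + f \<bar>0 - 0\<bar> \<le> f 0"
    using assms(2) by blast
  then show ?thesis
    by simp
qed

locale superadditive_derivative =
  fixes I :: "real set" and f f' :: "real \<Rightarrow> real"
  assumes interval: "(\<exists>a>0. I = {0..<a}) \<or> I = {0..}"
    and deriv: "t \<in> I \<Longrightarrow> (f has_real_derivative f' t) (at t within I)"
    and superadd: "superadditive_on I f'"
    and at_zero: "f 0 \<le> 0"
begin

lemma nonneg_mem: "t \<in> I \<Longrightarrow> 0 \<le> t"
  using interval by auto

lemma le_mem: "u \<in> I \<Longrightarrow> 0 \<le> t \<Longrightarrow> t \<le> u \<Longrightarrow> t \<in> I"
  using interval by auto

lemma deriv_at: "(f has_real_derivative f' t) (at t)" if t: "t \<in> I" "0 < t"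
proof -
  obtain S where S: "open S" "t \<in> S" "S \<subseteq> I"
  proof (cases "I = {0..}")
    case True
    with t show ?thesis
      by (intro that[of "{0<..}"]) auto
  next
    case False
    with interval obtain a where "I = {0..<a}"
      by blast
    with t show ?thesis
      by (intro that[of "{0<..<a}"]) auto
  qed
  have "at t within I = at t"
    by (rule at_within_open_subset[OF S(2,1,3)])
  with deriv[OF t(1)] show ?thesis
    by simp
qed

lemma superadd_le: "f' u + f' v \<le> f' (u + v)" if "u \<in> I" "v \<in> I" "u + v \<in> I"
  using superadd that unfolding superadditive_on_def by blast

lemma continuous: "continuous_on I f"
  unfolding continuous_on_eq_continuous_within
  using deriv DERIV_continuous by blast

text \<open>The slack in the superquadratic inequality at \<open>c\<close> when the constant there
  is taken to be \<open>f' c\<close>.\<close>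

definition excess :: "real \<Rightarrow> real \<Rightarrow> real" where
  "excess c y = f y - f c - f \<bar>y - c\<bar> - f' c * (y - c)"

text \<open>Allows the monotonicity proofs to differentiate on open intervals only, away from
  \<open>0\<close>, where \<open>f'\<close> is one-sided, and from the kink of
  \<open>\<bar>y - c\<bar>\<close> at \<open>c\<close>.\<close>

lemma continuous_excess: "continuous_on I (excess c)" if "c \<in> I"
proof -
  have "\<bar>y - c\<bar> \<in> I" if "y \<in> I" for y
    using nonneg_mem[OF that] nonneg_mem[OF \<open>c \<in> I\<close>]
      le_mem[OF that, of "\<bar>y - c\<bar>"] le_mem[OF \<open>c \<in> I\<close>, of "\<bar>y - c\<bar>"]
    by (cases "c \<le> y") simp_all
  then show ?thesis
    unfolding excess_def
    by (intro continuous_intros continuous continuous_on_compose2[OF continuous]) auto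
qed

text \<open>Right of \<open>c\<close> the derivative is \<open>f' t - f' (t - c) - f' c\<close>,
  which is nonnegative by superadditivity for \<open>t = (t - c) + c\<close>.\<close>

lemma excess_mono: "mono_on (I \<inter> {c..}) (excess c)" if c: "c \<in> I"
proof (rule monotone_onI)
  fix u v assume uv: "u \<in> I \<inter> {c..}" "v \<in> I \<inter> {c..}" "u \<le> v"
  show "excess c u \<le> excess c v"
  proof (cases "u = v")
    case False
    have "{u..v} \<subseteq> I"
      using uv nonneg_mem le_mem[of v] by force
    show ?thesis
    proof (rule DERIV_nonneg_imp_increasing_open[where f = "excess c"])
      show "continuous_on {u..v} (excess c)"
        using continuous_excess[OF c] \<open>{u..v} \<subseteq> I\<close> continuous_on_subset by blast
      fix t assume t: "u < t" "t < v"
      have mem: "t \<in> I" "t - c \<in> I" "0 < t" "0 < t - c"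
        using t uv nonneg_mem[OF c] le_mem[of v] by auto
      have "((\<lambda>y. f (y - c)) has_real_derivative f' (t - c) * 1) (at t)"
        by (rule DERIV_chain2[where f = f and g = "\<lambda>y. y - c", OF deriv_at[OF mem(2,4)]]) (auto intro!: derivative_eq_intros)
      with deriv_at[OF mem(1,3)]
      have "((\<lambda>y. f y - f c - f (y - c) - f' c * (y - c)) has_real_derivative
          f' t - f' (t - c) - f' c) (at t)"
        by (auto intro!: derivative_eq_intros)
      then have "(excess c has_real_derivative f' t - f' (t - c) - f' c) (at t)"
        by (rule has_field_derivative_transform_within_open[where S = "{c<..}"])
          (use mem in \<open>auto simp: excess_def\<close>)
      moreover have "0 \<le> f' t - f' (t - c) - f' c"
        using superadd_le[OF mem(2) c] mem(1) by simp
      ultimately show "\<exists>y. (excess c has_real_derivative y) (at t) \<and> 0 \<le> y"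
        by blast
    qed (use uv in auto)
  qed simp
qed

text \<open>Left of \<open>c\<close> the inner derivative of \<open>c - y\<close> flips a sign: the
  derivative is \<open>f' t + f' (c - t) - f' c\<close>, nonpositive by superadditivity for
  \<open>c = t + (c - t)\<close>.\<close>

lemma excess_antimono: "antimono_on (I \<inter> {..c}) (excess c)" if c: "c \<in> I"
proof (rule monotone_onI)
  fix u v assume uv: "u \<in> I \<inter> {..c}" "v \<in> I \<inter> {..c}" "u \<le> v"
  show "excess c v \<le> excess c u"
  proof (cases "u = v")
    case False
    have "{u..v} \<subseteq> I"
      using uv nonneg_mem le_mem[of v] by force
    show ?thesis
    proof (rule DERIV_nonpos_imp_decreasing_open[where f = "excess c"])
      show "continuous_on {u..v} (excess c)"
        using continuous_excess[OF c] \<open>{u..v} \<subseteq> I\<close> continuous_on_subset by blast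
      fix t assume t: "u < t" "t < v"
      have mem: "t \<in> I" "c - t \<in> I" "0 < t" "0 < c - t"
        using t uv nonneg_mem[of u] le_mem[of c] c by auto
      have "((\<lambda>y. f (c - y)) has_real_derivative f' (c - t) * (- 1)) (at t)"
        by (rule DERIV_chain2[where f = f and g = "\<lambda>y. c - y", OF deriv_at[OF mem(2,4)]]) (auto intro!: derivative_eq_intros)
      with deriv_at[OF mem(1,3)]
      have "((\<lambda>y. f y - f c - f (c - y) - f' c * (y - c)) has_real_derivative
          f' t + f' (c - t) - f' c) (at t)"
        by (auto intro!: derivative_eq_intros)
      then have "(excess c has_real_derivative f' t + f' (c - t) - f' c) (at t)"
        by (rule has_field_derivative_transform_within_open[where S = "{..<c}"])
          (use mem in \<open>auto simp: excess_def\<close>)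
      moreover have "f' t + f' (c - t) - f' c \<le> 0"
        using superadd_le[OF mem(1,2)] c by simp
      ultimately show "\<exists>y. (excess c has_real_derivative y) (at t) \<and> y \<le> 0"
        by blast
    qed (use uv in auto)
  qed simp
qed

lemma excess_nonneg: "0 \<le> excess c y" if "c \<in> I" "y \<in> I"
proof -
  have "excess c c \<le> excess c y"
    using that excess_mono[of c] excess_antimono[of c]
    by (cases "c \<le> y") (auto simp: monotone_on_def)
  moreover have "excess c c = - f 0"
    by (simp add: excess_def)
  ultimately show ?thesis
    using at_zero by linarith
qed

text \<open>The point \<open>y\<close> has its own weight \<open>s\<close> because its place among
  the \<open>x i\<close> is unknown; for it, nonnegativity of \<open>excess c y\<close> suffices.
  The balance condition removes the terms with \<open>f' c\<close>.\<close>

lemma jensen_steffensen_nonneg: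
  fixes r x :: "nat \<Rightarrow> real"
  assumes heads: "\<And>i. i \<in> {1..n} \<Longrightarrow> 0 \<le> (\<Sum>j=1..i. r j)"
    and tails: "\<And>i. i \<in> {1..n} \<Longrightarrow> 0 \<le> (\<Sum>j=i..n. r j)"
    and x: "mono_on {1..n} x" "\<And>i. i \<in> {1..n} \<Longrightarrow> x i \<in> I"
    and "0 \<le> s" "y \<in> I" "c \<in> I"
    and balance: "(\<Sum>i=1..n. r i * (x i - c)) + s * (y - c) = 0"
  shows "0 \<le> (\<Sum>i=1..n. r i * (f (x i) - f c - f \<bar>x i - c\<bar>)) + s * (f y - f c - f \<bar>y - c\<bar>)"
proof -
  have "0 \<le> (\<Sum>i=1..n. r i * excess c (x i)) + s * excess c y"
    using sum_mult_unimodal_nonneg[OF heads tails x excess_antimono excess_mono excess_nonneg] assms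
    by (simp add: excess_nonneg)
  also have "\<dots> = (\<Sum>i=1..n. r i * (f (x i) - f c - f \<bar>x i - c\<bar>)) + s * (f y - f c - f \<bar>y - c\<bar>)
      - f' c * ((\<Sum>i=1..n. r i * (x i - c)) + s * (y - c))"
    by (simp add: excess_def algebra_simps sum.distrib sum_subtractf sum_distrib_left)
  finally show ?thesis
    using balance by simp
qed

end

section \<open>Means and tail sums of signed weights\<close>

text \<open>Keeps the means inside the interval although weights may be negative. Both bounds are
  Abel summation, for the nonnegative monotone sequences \<open>x i - x 1\<close> and
  \<open>x n - x i\<close>.\<close>

lemma weighted_mean_bounds:
  fixes p x :: "nat \<Rightarrow> real"
  assumes x: "mono_on {1..n} x" and total: "(\<Sum>i=1..n. p i) = 1"
    and heads: "\<And>i. i \<in> {1..n} \<Longrightarrow> 0 \<le> (\<Sum>j=1..i. p j)"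
    and tails: "\<And>i. i \<in> {1..n} \<Longrightarrow> 0 \<le> (\<Sum>j=i..n. p j)"
  shows "x 1 \<le> (\<Sum>i=1..n. p i * x i) \<and> (\<Sum>i=1..n. p i * x i) \<le> x n"
proof -
  have "0 < n"
    using total by (cases n) auto
  have "0 \<le> (\<Sum>i=1..n. p i * (x i - x 1))"
    using x \<open>0 < n\<close> by (intro sum_mult_mono_nonneg tails) (auto simp: monotone_on_def)
  moreover have "0 \<le> (\<Sum>i=1..n. p i * (x n - x i))"
    using x \<open>0 < n\<close> by (intro sum_mult_antimono_nonneg heads) (auto simp: monotone_on_def)
  ultimately show ?thesis
    using total by (simp add: right_diff_distrib sum_subtractf flip: sum_distrib_right)
qed

lemma sum_tail_eq:
  fixes p :: "nat \<Rightarrow> real"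
  assumes "i \<in> {1..n}"
  shows "(\<Sum>j=i..n. p j) = (\<Sum>j=1..n. p j) - (\<Sum>j=1..i-1. p j)"
proof -
  have "{1..n} = {1..i-1} \<union> {i..n}"
    using assms by auto
  moreover have "{1..i-1} \<inter> {i..n} = {}"
    by auto
  ultimately show ?thesis
    by (simp add: sum.union_disjoint)
qed

section \<open>Application to the weights \<open>p - m q\<close> and \<open>M q - p\<close>\<close>

theorem theorem19:
  fixes I :: "real set" and f f' :: "real \<Rightarrow> real"
    and n :: nat and x p q :: "nat \<Rightarrow> real"
  assumes "(\<exists>a>0. I = {0..<a}) \<or> I = {0..}"
    and "superquadratic_on I f"
    and "\<And>t. t \<in> I \<Longrightarrow> (f has_real_derivative f' t) (at t within I)"
    and "superadditive_on I f'"
    and "\<And>i. i \<in> {1..n} \<Longrightarrow> x i \<in> I"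
    and "mono_on {1..n} x"
    and "\<exists>i\<in>{1..n}. p i \<noteq> q i"
    and "(\<Sum>i=1..n. p i) = 1"
    and "(\<Sum>i=1..n. q i) = 1"
    and "\<And>i. i \<in> {1..n} \<Longrightarrow> 0 \<le> (\<Sum>j=1..i. p j) \<and> (\<Sum>j=1..i. p j) \<le> 1"
    and "\<And>i. i \<in> {1..<n} \<Longrightarrow> 0 < (\<Sum>j=1..i. q j) \<and> (\<Sum>j=1..i. q j) < 1"
  shows "jensen_functional n f x p - min_ratio n p q * jensen_functional n f x q
           \<ge> min_ratio n p q * f \<bar>\<Sum>i=1..n. (q i - p i) * x i\<bar>
             + (\<Sum>i=1..n. (p i - min_ratio n p q * q i) * f \<bar>x i - (\<Sum>j=1..n. p j * x j)\<bar>)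
       \<and> jensen_functional n f x p - max_ratio n p q * jensen_functional n f x q
           \<le> - (\<Sum>i=1..n. (max_ratio n p q * q i - p i) * f \<bar>x i - (\<Sum>j=1..n. q j * x j)\<bar>)
             - f \<bar>\<Sum>i=1..n. (p i - q i) * x i\<bar>"
proof -
  interpret superadditive_derivative I f f'
    using assms(1-4) superquadratic_on_zero[OF assms(2)] by unfold_locales auto

  have "0 < n"
    using assms(8) by (cases n) auto
  have p_head: "0 \<le> (\<Sum>j=1..i. p j)" if "i \<in> {1..n}" for i
    using assms(10)[OF that] by simp
  \<comment> \<open>The strict bounds stop at \<open>n - 1\<close>; at \<open>i = n\<close> the head
    sum is the total 1.\<close>
  have q_head: "0 < (\<Sum>j=1..i. q j)" if "i \<in> {1..n}" for i
    using assms(9) assms(11)[of i] that by (cases "i = n") auto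
  have p_tail: "0 \<le> (\<Sum>j=i..n. p j)" and q_tail: "0 < (\<Sum>j=i..n. q j)"
    if i: "i \<in> {1..n}" for i
  proof -
    \<comment> \<open>A tail is 1 minus the head ending at \<open>i - 1\<close>; for
      \<open>i = 1\<close> that head is empty.\<close>
    have "(\<Sum>j=1..i-1. p j) \<le> 1 \<and> (\<Sum>j=1..i-1. q j) < 1"
    proof (cases "i = 1")
      case False
      with i have "i - 1 \<in> {1..n}" "i - 1 \<in> {1..<n}"
        by auto
      with assms(10,11) show ?thesis
        by blast
    qed simp
    then show "0 \<le> (\<Sum>j=i..n. p j)" "0 < (\<Sum>j=i..n. q j)"
      unfolding sum_tail_eq[OF i] assms(8,9) by simp_all
  qed

  define m where "m = min_ratio n p q"
  define M where "M = max_ratio n p q"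
  let ?R = "head_ratio p q ` {1..n} \<union> tail_ratio n p q ` {1..n}"
  have head_le: "m \<le> head_ratio p q i" "head_ratio p q i \<le> M"
    and tail_le: "m \<le> tail_ratio n p q i" "tail_ratio n p q i \<le> M" if "i \<in> {1..n}" for i
    using that by (auto simp: m_def M_def min_ratio_def max_ratio_def intro!: Min_le Max_ge)
  \<comment> \<open>The minimum is attained, so \<open>m\<close> is a quotient of a nonnegative by a
    positive number. Its sign matters because \<open>m\<close> is the weight of the extra point
    \<open>Q\<close>.\<close>
  have "m \<in> ?R"
    unfolding m_def min_ratio_def using \<open>0 < n\<close> by (intro Min_in) auto
  then have "0 \<le> m"
    using p_head q_head p_tail q_tail
    by (auto simp: head_ratio_def tail_ratio_def intro!: divide_nonneg_pos)

  \<comment> \<open>These are the bounds \<open>m \<le> head_ratio p q i \<le> M\<close> multiplied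
    by the positive denominator.\<close>
  have head_sums: "0 \<le> (\<Sum>j=1..i. p j - m * q j)" "0 \<le> (\<Sum>j=1..i. M * q j - p j)"
    if "i \<in> {1..n}" for i
    using head_le[OF that] q_head[OF that]
    by (simp_all add: head_ratio_def field_simps sum_subtractf flip: sum_distrib_left)
  have tail_sums: "0 \<le> (\<Sum>j=i..n. p j - m * q j)" "0 \<le> (\<Sum>j=i..n. M * q j - p j)"
    if "i \<in> {1..n}" for i
    using tail_le[OF that] q_tail[OF that]
    by (simp_all add: tail_ratio_def field_simps sum_subtractf flip: sum_distrib_left)

  define P where "P = (\<Sum>i=1..n. p i * x i)"
  define Q where "Q = (\<Sum>i=1..n. q i * x i)"
  have ends: "0 \<le> x 1" "x n \<in> I"
    using \<open>0 < n\<close> assms(5) nonneg_mem by auto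
  have "P \<in> I"
    using weighted_mean_bounds[OF assms(6,8) p_head p_tail] ends le_mem[of "x n" P]
    by (simp add: P_def)
  have "Q \<in> I"
    using weighted_mean_bounds[OF assms(6,9) less_imp_le[OF q_head] less_imp_le[OF q_tail]]
      ends le_mem[of "x n" Q]
    by (simp add: Q_def)

  have sums: "(\<Sum>i=1..n. p i * t) = t" "(\<Sum>i=1..n. q i * t) = t" for t
    using assms(8,9) by (simp_all flip: sum_distrib_right)
  have "(\<Sum>i=1..n. (p i - m * q i) * (x i - P)) =
      P - m * Q - (\<Sum>i=1..n. p i * P) + m * (\<Sum>i=1..n. q i * P)"
    by (simp add: P_def Q_def algebra_simps sum.distrib sum_subtractf sum_distrib_left)
  then have balance_P: "(\<Sum>i=1..n. (p i - m * q i) * (x i - P)) + m * (Q - P) = 0"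
    unfolding sums by algebra
  have "(\<Sum>i=1..n. (M * q i - p i) * (x i - Q)) =
      M * Q - P - M * (\<Sum>i=1..n. q i * Q) + (\<Sum>i=1..n. p i * Q)"
    by (simp add: P_def Q_def algebra_simps sum.distrib sum_subtractf sum_distrib_left)
  then have balance_Q: "(\<Sum>i=1..n. (M * q i - p i) * (x i - Q)) + 1 * (P - Q) = 0"
    unfolding sums by algebra

  have diff: "(\<Sum>i=1..n. (q i - p i) * x i) = Q - P" "(\<Sum>i=1..n. (p i - q i) * x i) = P - Q"
    by (simp_all add: P_def Q_def left_diff_distrib sum_subtractf)

  \<comment> \<open>The sums with constant factor \<open>f P\<close> are kept whole so that
    \<open>sums\<close> can collapse them to \<open>f P\<close>.\<close>
  have split_P: "(\<Sum>i=1..n. (p i - m * q i) * (f (x i) - f P - f \<bar>x i - P\<bar>)) =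
      (\<Sum>i=1..n. p i * f (x i)) - m * (\<Sum>i=1..n. q i * f (x i))
      - (\<Sum>i=1..n. p i * f P) + m * (\<Sum>i=1..n. q i * f P)
      - (\<Sum>i=1..n. (p i - m * q i) * f \<bar>x i - P\<bar>)"
    by (simp add: algebra_simps sum.distrib sum_subtractf sum_distrib_left)
  have split_Q: "(\<Sum>i=1..n. (M * q i - p i) * (f (x i) - f Q - f \<bar>x i - Q\<bar>)) =
      M * (\<Sum>i=1..n. q i * f (x i)) - (\<Sum>i=1..n. p i * f (x i))
      - M * (\<Sum>i=1..n. q i * f Q) + (\<Sum>i=1..n. p i * f Q)
      - (\<Sum>i=1..n. (M * q i - p i) * f \<bar>x i - Q\<bar>)"
    by (simp add: algebra_simps sum.distrib sum_subtractf sum_distrib_left)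

  have "0 \<le> (\<Sum>i=1..n. (p i - m * q i) * (f (x i) - f P - f \<bar>x i - P\<bar>))
      + m * (f Q - f P - f \<bar>Q - P\<bar>)"
    by (rule jensen_steffensen_nonneg[OF head_sums(1) tail_sums(1) assms(6) assms(5)
          \<open>0 \<le> m\<close> \<open>Q \<in> I\<close> \<open>P \<in> I\<close> balance_P])
  \<comment> \<open>The two terms \<open>m * f P\<close> cancel; \<open>- f P\<close> and
    \<open>m * f Q\<close> complete the two Jensen functionals.\<close>
  then have lower: "m * f \<bar>Q - P\<bar> + (\<Sum>i=1..n. (p i - m * q i) * f \<bar>x i - P\<bar>)
      \<le> jensen_functional n f x p - m * jensen_functional n f x q"
    unfolding jensen_functional_def P_def[symmetric] Q_def[symmetric] split_P sums
    by (simp add: algebra_simps)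
  have "0 \<le> (\<Sum>i=1..n. (M * q i - p i) * (f (x i) - f Q - f \<bar>x i - Q\<bar>))
      + 1 * (f P - f Q - f \<bar>P - Q\<bar>)"
    by (rule jensen_steffensen_nonneg[OF head_sums(2) tail_sums(2) assms(6) assms(5)
          zero_le_one \<open>P \<in> I\<close> \<open>Q \<in> I\<close> balance_Q])
  \<comment> \<open>Here the two terms \<open>f Q\<close> cancel, while \<open>f P\<close> and
    \<open>- M * f Q\<close> complete the functionals.\<close>
  then have upper: "jensen_functional n f x p - M * jensen_functional n f x q
      \<le> - (\<Sum>i=1..n. (M * q i - p i) * f \<bar>x i - Q\<bar>) - f \<bar>P - Q\<bar>"
    unfolding jensen_functional_def P_def[symmetric] Q_def[symmetric] split_Q sums
    by (simp add: algebra_simps)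
  show ?thesis
    using lower upper
    unfolding diff P_def[symmetric] Q_def[symmetric] m_def[symmetric] M_def[symmetric] by blast
qed

end
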